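(* For an integer $n\geq 0$, the Lucas-Leonardo quaternion $\mathbb{Q}\mathcal{R}_{n}$ is a zero divisor in the quaternion algebra $\mathbb{Q}_{\mathbb{Z}_{3}}$ if and only if $n\equiv 0,2,3 \pmod 8$.
   Context: The Lucas-Leonardo numbers are defined by $\mathcal{R}_{0}=3$, $\mathcal{R}_{1}=1$, $\mathcal{R}_{n}=\mathcal{R}_{n-1}+\mathcal{R}_{n-2}+1$ for $n\geq 2$. For an odd prime $q$, let $\mathbb{Z}_q$ be the field with $q$ elements and $\mathbb{Q}_{\mathbb{Z}_{q}}$ the quaternion algebra over $\mathbb{Z}_q$ with basis $1,i,j,k$ and relations $i^{2}=j^{2}=-1$, $ij=-ji=k$. The $n$-th Lucas-Leonardo quaternion is $\mathbb{Q}\mathcal{R}_{n}=\mathcal{R}_{n}+\mathcal{R}_{n+1}i+\mathcal{R}_{n+2}j+\mathcal{R}_{n+3}k$, regarded as an element of $\mathbb{Q}_{\mathbb{Z}_{q}}$ by reducing its coefficients modulo $q$. *)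

theory Defs
  imports "HOL-Algebra.Module" "HOL-Number_Theory.Residues"
begin

fun lucas_leonardo :: "nat \<Rightarrow> int" where
  "lucas_leonardo 0 = 3"
| "lucas_leonardo (Suc 0) = 1"
| "lucas_leonardo (Suc (Suc n)) = lucas_leonardo (Suc n) + lucas_leonardo n + 1"

text \<open>\<open>Quat a b c d\<close> stands for \<open>a + b i + c j + d k\<close>.\<close>

datatype 'a quat = Quat 'a 'a 'a 'a

text \<open>
  The product below is the bilinear extension of the products of basis elements determined by
  \<open>i\<^sup>2 = j\<^sup>2 = -1\<close> and \<open>ij = -ji = k\<close>. The record type is that of modules, so that scalar
  multiplication is included; the library's locale \<open>algebra\<close> does not apply, as it requires
  the multiplication to be commutative.
\<close>

definition quaternion_algebra :: "('a, 'm) ring_scheme \<Rightarrow> ('a, 'a quat) module" where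
  "quaternion_algebra R =
    \<lparr>carrier = {Quat a b c d | a b c d.
       a \<in> carrier R \<and> b \<in> carrier R \<and> c \<in> carrier R \<and> d \<in> carrier R},
     monoid.mult = (\<lambda>x y. case x of Quat a b c d \<Rightarrow> case y of Quat a' b' c' d' \<Rightarrow>
       Quat (a \<otimes>\<^bsub>R\<^esub> a' \<ominus>\<^bsub>R\<^esub> b \<otimes>\<^bsub>R\<^esub> b' \<ominus>\<^bsub>R\<^esub> c \<otimes>\<^bsub>R\<^esub> c' \<ominus>\<^bsub>R\<^esub> d \<otimes>\<^bsub>R\<^esub> d')
            (a \<otimes>\<^bsub>R\<^esub> b' \<oplus>\<^bsub>R\<^esub> b \<otimes>\<^bsub>R\<^esub> a' \<oplus>\<^bsub>R\<^esub> c \<otimes>\<^bsub>R\<^esub> d' \<ominus>\<^bsub>R\<^esub> d \<otimes>\<^bsub>R\<^esub> c')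
            (a \<otimes>\<^bsub>R\<^esub> c' \<ominus>\<^bsub>R\<^esub> b \<otimes>\<^bsub>R\<^esub> d' \<oplus>\<^bsub>R\<^esub> c \<otimes>\<^bsub>R\<^esub> a' \<oplus>\<^bsub>R\<^esub> d \<otimes>\<^bsub>R\<^esub> b')
            (a \<otimes>\<^bsub>R\<^esub> d' \<oplus>\<^bsub>R\<^esub> b \<otimes>\<^bsub>R\<^esub> c' \<ominus>\<^bsub>R\<^esub> c \<otimes>\<^bsub>R\<^esub> b' \<oplus>\<^bsub>R\<^esub> d \<otimes>\<^bsub>R\<^esub> a')),
     one = Quat \<one>\<^bsub>R\<^esub> \<zero>\<^bsub>R\<^esub> \<zero>\<^bsub>R\<^esub> \<zero>\<^bsub>R\<^esub>,
     ring.zero = Quat \<zero>\<^bsub>R\<^esub> \<zero>\<^bsub>R\<^esub> \<zero>\<^bsub>R\<^esub> \<zero>\<^bsub>R\<^esub>,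
     add = (\<lambda>x y. case x of Quat a b c d \<Rightarrow> case y of Quat a' b' c' d' \<Rightarrow>
       Quat (a \<oplus>\<^bsub>R\<^esub> a') (b \<oplus>\<^bsub>R\<^esub> b') (c \<oplus>\<^bsub>R\<^esub> c') (d \<oplus>\<^bsub>R\<^esub> d')),
     smult = (\<lambda>r x. case x of Quat a b c d \<Rightarrow>
       Quat (r \<otimes>\<^bsub>R\<^esub> a) (r \<otimes>\<^bsub>R\<^esub> b) (r \<otimes>\<^bsub>R\<^esub> c) (r \<otimes>\<^bsub>R\<^esub> d))\<rparr>"

definition quat_i :: "('a, 'm) ring_scheme \<Rightarrow> 'a quat" where
  "quat_i R = Quat \<zero>\<^bsub>R\<^esub> \<one>\<^bsub>R\<^esub> \<zero>\<^bsub>R\<^esub> \<zero>\<^bsub>R\<^esub>"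

definition quat_j :: "('a, 'm) ring_scheme \<Rightarrow> 'a quat" where
  "quat_j R = Quat \<zero>\<^bsub>R\<^esub> \<zero>\<^bsub>R\<^esub> \<one>\<^bsub>R\<^esub> \<zero>\<^bsub>R\<^esub>"

definition quat_k :: "('a, 'm) ring_scheme \<Rightarrow> 'a quat" where
  "quat_k R = Quat \<zero>\<^bsub>R\<^esub> \<zero>\<^bsub>R\<^esub> \<zero>\<^bsub>R\<^esub> \<one>\<^bsub>R\<^esub>"

definition lucas_leonardo_quat :: "nat \<Rightarrow> nat \<Rightarrow> int quat" where
  "lucas_leonardo_quat q n =
     Quat (lucas_leonardo n mod int q) (lucas_leonardo (n + 1) mod int q)
          (lucas_leonardo (n + 2) mod int q) (lucas_leonardo (n + 3) mod int q)"

text \<open>In a noncommutative ring, a zero divisor may be one on either side; zero is excluded.\<close>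

definition zero_divisor :: "('a, 'm) ring_scheme \<Rightarrow> 'a \<Rightarrow> bool" where
  "zero_divisor R x \<longleftrightarrow> x \<in> carrier R \<and> x \<noteq> \<zero>\<^bsub>R\<^esub> \<and>
     (\<exists>y\<in>carrier R. y \<noteq> \<zero>\<^bsub>R\<^esub> \<and> (x \<otimes>\<^bsub>R\<^esub> y = \<zero>\<^bsub>R\<^esub> \<or> y \<otimes>\<^bsub>R\<^esub> x = \<zero>\<^bsub>R\<^esub>))"

context cring
begin

lemma quaternion_ring: "ring (quaternion_algebra R)"
proof (rule ringI)
  show "abelian_group (quaternion_algebra R)"
  proof (rule abelian_groupI)
    fix x assume "x \<in> carrier (quaternion_algebra R)"
    then obtain a b c d where x: "x = Quat a b c d"
      "a \<in> carrier R" "b \<in> carrier R" "c \<in> carrier R" "d \<in> carrier R"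
      by (auto simp: quaternion_algebra_def)
    then show "\<exists>y\<in>carrier (quaternion_algebra R).
        y \<oplus>\<^bsub>quaternion_algebra R\<^esub> x = \<zero>\<^bsub>quaternion_algebra R\<^esub>"
      by (intro bexI[of _ "Quat (\<ominus> a) (\<ominus> b) (\<ominus> c) (\<ominus> d)"])
         (auto simp: quaternion_algebra_def l_neg)
  qed (auto simp: quaternion_algebra_def a_ac)
  show "Group.monoid (quaternion_algebra R)"
  proof (rule monoidI)
    fix x y z
    assume "x \<in> carrier (quaternion_algebra R)" "y \<in> carrier (quaternion_algebra R)"
      "z \<in> carrier (quaternion_algebra R)"
    then show "(x \<otimes>\<^bsub>quaternion_algebra R\<^esub> y) \<otimes>\<^bsub>quaternion_algebra R\<^esub> z =
        x \<otimes>\<^bsub>quaternion_algebra R\<^esub> (y \<otimes>\<^bsub>quaternion_algebra R\<^esub> z)"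
      by (auto simp: quaternion_algebra_def minus_eq l_distr r_distr l_minus r_minus minus_add
          m_assoc a_ac)
  qed (auto simp: quaternion_algebra_def minus_eq)
qed (auto simp: quaternion_algebra_def minus_eq l_distr r_distr minus_add a_ac)

lemma quaternion_module: "module R (quaternion_algebra R)"
  by (intro module.intro is_cring module_axioms.intro ring.is_abelian_group quaternion_ring)
     (auto simp: quaternion_algebra_def l_distr r_distr m_assoc)

lemma quaternion_smult_mult:
  assumes "r \<in> carrier R" "x \<in> carrier (quaternion_algebra R)"
    "y \<in> carrier (quaternion_algebra R)"
  shows "(r \<odot>\<^bsub>quaternion_algebra R\<^esub> x) \<otimes>\<^bsub>quaternion_algebra R\<^esub> y =
           r \<odot>\<^bsub>quaternion_algebra R\<^esub> (x \<otimes>\<^bsub>quaternion_algebra R\<^esub> y)"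
    and "x \<otimes>\<^bsub>quaternion_algebra R\<^esub> (r \<odot>\<^bsub>quaternion_algebra R\<^esub> y) =
           r \<odot>\<^bsub>quaternion_algebra R\<^esub> (x \<otimes>\<^bsub>quaternion_algebra R\<^esub> y)"
  using assms
  by (auto simp: quaternion_algebra_def minus_eq r_distr l_minus r_minus m_assoc m_lcomm)

lemma quaternion_relations:
  defines "Q \<equiv> quaternion_algebra R"
  shows "quat_i R \<otimes>\<^bsub>Q\<^esub> quat_i R = \<ominus>\<^bsub>Q\<^esub> \<one>\<^bsub>Q\<^esub>"
    and "quat_j R \<otimes>\<^bsub>Q\<^esub> quat_j R = \<ominus>\<^bsub>Q\<^esub> \<one>\<^bsub>Q\<^esub>"
    and "quat_i R \<otimes>\<^bsub>Q\<^esub> quat_j R = quat_k R"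
    and "\<ominus>\<^bsub>Q\<^esub> (quat_j R \<otimes>\<^bsub>Q\<^esub> quat_i R) = quat_k R"
proof -
  interpret Q: ring Q
    unfolding Q_def by (rule quaternion_ring)
  have "quat_i R \<otimes>\<^bsub>Q\<^esub> quat_i R \<oplus>\<^bsub>Q\<^esub> \<one>\<^bsub>Q\<^esub> = \<zero>\<^bsub>Q\<^esub>"
    "quat_j R \<otimes>\<^bsub>Q\<^esub> quat_j R \<oplus>\<^bsub>Q\<^esub> \<one>\<^bsub>Q\<^esub> = \<zero>\<^bsub>Q\<^esub>"
    "quat_k R \<oplus>\<^bsub>Q\<^esub> quat_j R \<otimes>\<^bsub>Q\<^esub> quat_i R = \<zero>\<^bsub>Q\<^esub>"
    by (simp_all add: Q_def quaternion_algebra_def quat_i_def quat_j_def quat_k_def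
        minus_eq l_neg r_neg)
  moreover have "quat_i R \<in> carrier Q" "quat_j R \<in> carrier Q" "quat_k R \<in> carrier Q"
    by (auto simp: Q_def quaternion_algebra_def quat_i_def quat_j_def quat_k_def)
  ultimately show "quat_i R \<otimes>\<^bsub>Q\<^esub> quat_i R = \<ominus>\<^bsub>Q\<^esub> \<one>\<^bsub>Q\<^esub>"
    "quat_j R \<otimes>\<^bsub>Q\<^esub> quat_j R = \<ominus>\<^bsub>Q\<^esub> \<one>\<^bsub>Q\<^esub>"
    "\<ominus>\<^bsub>Q\<^esub> (quat_j R \<otimes>\<^bsub>Q\<^esub> quat_i R) = quat_k R"
    by (metis Q.minus_equality Q.m_closed Q.one_closed)+
  show "quat_i R \<otimes>\<^bsub>Q\<^esub> quat_j R = quat_k R"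
    by (simp add: Q_def quaternion_algebra_def quat_i_def quat_j_def quat_k_def minus_eq)
qed

lemma quaternion_basis:
  assumes "a \<in> carrier R" "b \<in> carrier R" "c \<in> carrier R" "d \<in> carrier R"
  defines "Q \<equiv> quaternion_algebra R"
  shows "Quat a b c d = a \<odot>\<^bsub>Q\<^esub> \<one>\<^bsub>Q\<^esub> \<oplus>\<^bsub>Q\<^esub> b \<odot>\<^bsub>Q\<^esub> quat_i R \<oplus>\<^bsub>Q\<^esub>
           c \<odot>\<^bsub>Q\<^esub> quat_j R \<oplus>\<^bsub>Q\<^esub> d \<odot>\<^bsub>Q\<^esub> quat_k R"
  using assms by (simp add: quaternion_algebra_def quat_i_def quat_j_def quat_k_def)

end

end

theory Submission
  imports Defs
begin

text \<open>
  A quaternion \<open>x\<close> over an integral domain satisfies \<open>x * conj x = conj x * x = N x\<close>, where \<open>N x\<close>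
  is the sum of the squares of its coefficients. If \<open>N x = 0\<close>, the conjugate annihilates \<open>x\<close>; if
  \<open>N x \<noteq> 0\<close>, then \<open>x y = 0\<close> or \<open>y x = 0\<close> gives \<open>N x * y = 0\<close> after multiplication by \<open>conj x\<close>,
  and therefore \<open>y = 0\<close>. So the zero divisors are the nonzero quaternions of norm zero
  (\<open>zero_divisor_quaternion_iff\<close>).

  Modulo 3 the Lucas-Leonardo numbers repeat with period 8, namely
  \<open>0, 1, 2, 1, 1, 0, 2, 0\<close> (\<open>lucas_leonardo_mod_3\<close>). A square is 0 or 1 modulo 3, so the
  norm of the \<open>n\<close>-th quaternion vanishes exactly when one or all four of the entries
  \<open>n, \<dots>, n + 3\<close> of this cyclic word are 0. The latter never happens, since two consecutive zeros are
  followed by a 1, and exactly one zero occurs for \<open>n = 0, 2, 3\<close> modulo 8.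
\<close>

fun quat_conj :: "('a, 'm) ring_scheme \<Rightarrow> 'a quat \<Rightarrow> 'a quat" where
  "quat_conj R (Quat a b c d) = Quat a (\<ominus>\<^bsub>R\<^esub> b) (\<ominus>\<^bsub>R\<^esub> c) (\<ominus>\<^bsub>R\<^esub> d)"

fun quat_norm :: "('a, 'm) ring_scheme \<Rightarrow> 'a quat \<Rightarrow> 'a" where
  "quat_norm R (Quat a b c d) =
     a \<otimes>\<^bsub>R\<^esub> a \<oplus>\<^bsub>R\<^esub> b \<otimes>\<^bsub>R\<^esub> b \<oplus>\<^bsub>R\<^esub> c \<otimes>\<^bsub>R\<^esub> c \<oplus>\<^bsub>R\<^esub> d \<otimes>\<^bsub>R\<^esub> d"

context cring
begin

lemma quat_norm_closed:
  "x \<in> carrier (quaternion_algebra R) \<Longrightarrow> quat_norm R x \<in> carrier R"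
  by (auto simp: quaternion_algebra_def)

lemma quat_conj_closed:
  "x \<in> carrier (quaternion_algebra R) \<Longrightarrow> quat_conj R x \<in> carrier (quaternion_algebra R)"
  by (auto simp: quaternion_algebra_def)

lemma quat_conj_eq_zero_iff:
  assumes "x \<in> carrier (quaternion_algebra R)"
  shows "quat_conj R x = \<zero>\<^bsub>quaternion_algebra R\<^esub> \<longleftrightarrow> x = \<zero>\<^bsub>quaternion_algebra R\<^esub>"
  using assms by (auto simp: quaternion_algebra_def)

lemma quat_mult_conj:
  assumes "x \<in> carrier (quaternion_algebra R)"
  shows "x \<otimes>\<^bsub>quaternion_algebra R\<^esub> quat_conj R x =
           quat_norm R x \<odot>\<^bsub>quaternion_algebra R\<^esub> \<one>\<^bsub>quaternion_algebra R\<^esub>"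
    and "quat_conj R x \<otimes>\<^bsub>quaternion_algebra R\<^esub> x =
           quat_norm R x \<odot>\<^bsub>quaternion_algebra R\<^esub> \<one>\<^bsub>quaternion_algebra R\<^esub>"
proof -
  \<comment> \<open>Both terms of a mixed coefficient such as \<open>a c + b d - a c - b d\<close> cancel, although AC-rewriting
    does not place them next to their negatives.\<close>
  have cancel: "u \<oplus> (v \<oplus> (\<ominus> u \<oplus> \<ominus> v)) = \<zero>" if "u \<in> carrier R" "v \<in> carrier R" for u v
    using that by (metis a_assoc add.inv_closed add.m_closed minus_add r_neg)
  obtain a b c d where "x = Quat a b c d"
      "a \<in> carrier R" "b \<in> carrier R" "c \<in> carrier R" "d \<in> carrier R"
    using assms by (auto simp: quaternion_algebra_def)
  then show "x \<otimes>\<^bsub>quaternion_algebra R\<^esub> quat_conj R x =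
           quat_norm R x \<odot>\<^bsub>quaternion_algebra R\<^esub> \<one>\<^bsub>quaternion_algebra R\<^esub>"
    and "quat_conj R x \<otimes>\<^bsub>quaternion_algebra R\<^esub> x =
           quat_norm R x \<odot>\<^bsub>quaternion_algebra R\<^esub> \<one>\<^bsub>quaternion_algebra R\<^esub>"
    by (simp_all add: quaternion_algebra_def minus_eq l_minus r_minus)
       (simp_all add: m_comm a_ac r_neg r_neg1 r_neg2 cancel)
qed

end

text \<open>
  Multiplying by the conjugate turns an annihilator of a quaternion into an annihilator of its norm,
  which is a scalar; this reduces the question to the absence of zero divisors in \<open>R\<close>.
\<close>

lemma (in domain) zero_divisor_quaternion_iff:
  "zero_divisor (quaternion_algebra R) x \<longleftrightarrow>
     x \<in> carrier (quaternion_algebra R) \<and> x \<noteq> \<zero>\<^bsub>quaternion_algebra R\<^esub> \<and> quat_norm R x = \<zero>"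
proof -
  define Q where "Q = quaternion_algebra R"
  interpret Q: ring Q unfolding Q_def by (rule quaternion_ring)
  interpret M: module R Q unfolding Q_def by (rule quaternion_module)
  have smult_zero: "y = \<zero>\<^bsub>Q\<^esub>" if "r \<odot>\<^bsub>Q\<^esub> y = \<zero>\<^bsub>Q\<^esub>" "r \<in> carrier R" "r \<noteq> \<zero>" "y \<in> carrier Q" for r y
    using that by (auto simp: Q_def quaternion_algebra_def integral_iff)
  show ?thesis unfolding Q_def[symmetric]
  proof (cases "x \<in> carrier Q \<and> x \<noteq> \<zero>\<^bsub>Q\<^esub>")
    case False
    then show "zero_divisor Q x \<longleftrightarrow> x \<in> carrier Q \<and> x \<noteq> \<zero>\<^bsub>Q\<^esub> \<and> quat_norm R x = \<zero>"
      by (auto simp: zero_divisor_def)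
  next
    case True
    then have x: "x \<in> carrier Q" and nz: "x \<noteq> \<zero>\<^bsub>Q\<^esub>" by auto
    have c: "quat_conj R x \<in> carrier Q" and N: "quat_norm R x \<in> carrier R"
      using x quat_conj_closed quat_norm_closed by (auto simp: Q_def)
    note conj = quat_mult_conj[of x, folded Q_def, OF x]
    have "zero_divisor Q x" if "quat_norm R x = \<zero>"
      unfolding zero_divisor_def
    proof (intro conjI x nz bexI[OF _ c] disjI1)
      show "quat_conj R x \<noteq> \<zero>\<^bsub>Q\<^esub>"
        using quat_conj_eq_zero_iff x nz by (simp add: Q_def)
      show "x \<otimes>\<^bsub>Q\<^esub> quat_conj R x = \<zero>\<^bsub>Q\<^esub>"
        using conj(1) that by simp
    qed
    moreover have "quat_norm R x = \<zero>" if "zero_divisor Q x"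
    proof (rule ccontr)
      assume N0: "quat_norm R x \<noteq> \<zero>"
      from that obtain y where y: "y \<in> carrier Q" "y \<noteq> \<zero>\<^bsub>Q\<^esub>"
        and xy: "x \<otimes>\<^bsub>Q\<^esub> y = \<zero>\<^bsub>Q\<^esub> \<or> y \<otimes>\<^bsub>Q\<^esub> x = \<zero>\<^bsub>Q\<^esub>"
        by (auto simp: zero_divisor_def)
      note smult = quaternion_smult_mult[of "quat_norm R x", folded Q_def, OF N]
      from xy have "quat_norm R x \<odot>\<^bsub>Q\<^esub> y = \<zero>\<^bsub>Q\<^esub>"
      proof
        assume "x \<otimes>\<^bsub>Q\<^esub> y = \<zero>\<^bsub>Q\<^esub>"
        then have "(quat_conj R x \<otimes>\<^bsub>Q\<^esub> x) \<otimes>\<^bsub>Q\<^esub> y = \<zero>\<^bsub>Q\<^esub>"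
          using x c y by (simp add: Q.m_assoc)
        then show ?thesis using y by (simp add: conj(2) smult)
      next
        assume "y \<otimes>\<^bsub>Q\<^esub> x = \<zero>\<^bsub>Q\<^esub>"
        then have "y \<otimes>\<^bsub>Q\<^esub> (x \<otimes>\<^bsub>Q\<^esub> quat_conj R x) = \<zero>\<^bsub>Q\<^esub>"
          using x c y by (simp flip: Q.m_assoc)
        then show ?thesis using y by (simp add: conj(1) smult)
      qed
      then show False using smult_zero N N0 y by blast
    qed
    ultimately show "zero_divisor Q x \<longleftrightarrow> x \<in> carrier Q \<and> x \<noteq> \<zero>\<^bsub>Q\<^esub> \<and> quat_norm R x = \<zero>"
      using x nz by blast
  qed
qed

lemma lucas_leonardo_mod_3:
  "lucas_leonardo n mod 3 = [0, 1, 2, 1, 1, 0, 2, 0] ! (n mod 8)"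
proof (induction n rule: less_induct)
  case (less n)
  show ?case
  proof (cases "n < 8")
    case True
    have small: "lucas_leonardo 2 = 5" "lucas_leonardo 3 = 7" "lucas_leonardo 4 = 13"
        "lucas_leonardo 5 = 21" "lucas_leonardo 6 = 35" "lucas_leonardo 7 = 57"
      by (simp_all add: eval_nat_numeral)
    from True consider "n = 0" | "n = 1" | "n = 2" | "n = 3" | "n = 4" | "n = 5" | "n = 6" | "n = 7"
      by linarith
    then show ?thesis
      by cases (simp_all add: small)
  next
    case False
    then obtain m where n: "n = m + 8"
      by (metis add.commute le_add_diff_inverse not_less)
    \<comment> \<open>Eight steps of the recurrence give \<open>21 R\<^sub>m\<^sub>+\<^sub>1 + 13 R\<^sub>m + 33\<close>.\<close>
    have "lucas_leonardo (m + 8) = lucas_leonardo m +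
        3 * (7 * lucas_leonardo (m + 1) + 4 * lucas_leonardo m + 11)"
      by (simp add: eval_nat_numeral)
    then have "lucas_leonardo n mod 3 = lucas_leonardo m mod 3"
      by (simp only: n mod_mult_self2)
    then show ?thesis using less.IH[of m] by (simp add: n)
  qed
qed

theorem proposition5:
  fixes n :: nat
  shows "zero_divisor (quaternion_algebra (residue_ring (int 3))) (lucas_leonardo_quat 3 n)
    \<longleftrightarrow> [n = 0] (mod 8) \<or> [n = 2] (mod 8) \<or> [n = 3] (mod 8)"
proof -
  interpret residues_prime 3 "residue_ring (int 3)"
    by unfold_locales simp_all
  define w :: "int list" where "w = [0, 1, 2, 1, 1, 0, 2, 0]"
  define r where "r = n mod 8"
  have "lucas_leonardo (n + k) mod int 3 = w ! ((r + k) mod 8)" for k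
    by (simp add: lucas_leonardo_mod_3 w_def r_def mod_add_left_eq)
  from this[of 0] this[of 1] this[of 2] this[of 3]
  have quat: "lucas_leonardo_quat 3 n =
      Quat (w ! (r mod 8)) (w ! ((r + 1) mod 8)) (w ! ((r + 2) mod 8)) (w ! ((r + 3) mod 8))"
    by (simp only: lucas_leonardo_quat_def add_0_right)
  have "r < 8" by (simp add: r_def)
  then consider "r = 0" | "r = 1" | "r = 2" | "r = 3" | "r = 4" | "r = 5" | "r = 6" | "r = 7"
    by linarith
  then have "zero_divisor (quaternion_algebra (residue_ring (int 3))) (lucas_leonardo_quat 3 n)
      \<longleftrightarrow> r = 0 \<or> r = 2 \<or> r = 3"
    unfolding zero_divisor_quaternion_iff quat
    by cases (simp_all add: w_def quaternion_algebra_def residue_ring_def)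
  then show ?thesis
    by (simp add: cong_def r_def)
qed

end
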